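(* Let $n\in\mathbb{N}$ and $\alpha=n/2$. Then for all $f\in L^2(\mathbb{R}^n)$, $$\|e^{-t(-\Delta)^{\alpha}}f\|_{L^2_t((0,\infty);BMO_x(\mathbb{R}^n))}\lesssim \|f\|_{L^2(\mathbb{R}^n)}.$$
   Context: For $t\ge 0$, $e^{-t(-\Delta)^{\alpha}}f=\mathcal{F}^{-1}\big(e^{-t|\xi|^{2\alpha}}\mathcal{F}f(\xi)\big)$, where $\mathcal{F}$ is the Fourier transform on $\mathbb{R}^n$. $BMO(\mathbb{R}^n)$ is the space of locally integrable $f$ with $\|f\|_{BMO}=\big(\sup_Q \mathcal{L}(Q)^{-n}\int_Q|f(x)-f_Q|^2dx\big)^{1/2}<\infty$, the supremum over cubes $Q$ with sides parallel to the axes, $\mathcal{L}(Q)$ the sidelength, $f_Q$ the average of $f$ on $Q$. $A\lesssim B$ means $A\le CB$ for a positive constant $C$ independent of $f$. *)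

theory Defs
  imports "HOL-Analysis.Analysis"
begin

definition L2 :: "('a::euclidean_space \<Rightarrow> complex) set" where
  "L2 = {f. f \<in> borel_measurable lborel \<and> integrable lborel (\<lambda>x. (norm (f x))\<^sup>2)}"

text \<open>Fourier transform of f restricted to the ball of radius R (well defined for f in L^2).
  Convention: Ff(xi) = integral of f(x) exp(-2 pi i x.xi).\<close>
definition trunc_fourier :: "real \<Rightarrow> ('a::euclidean_space \<Rightarrow> complex) \<Rightarrow> 'a \<Rightarrow> complex" where
  "trunc_fourier R f \<xi> = (LINT x : ball 0 R | lborel. f x * cis (- 2 * pi * (x \<bullet> \<xi>)))"

definition fourier_L2 :: "('a::euclidean_space \<Rightarrow> complex) \<Rightarrow> 'a \<Rightarrow> complex" where
  "fourier_L2 f = (SOME g. g \<in> L2 \<and>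
     ((\<lambda>R. \<integral>\<^sup>+ \<xi>. ennreal ((norm (trunc_fourier R f \<xi> - g \<xi>))\<^sup>2) \<partial>lborel) \<longlongrightarrow> 0) at_top)"

text \<open>The semigroup e^{-t(-Delta)^alpha} f with alpha = n/2, i.e. multiplier exp(-t |xi|^n),
  n = DIM('a), given as the inverse Fourier transform of exp(-t|xi|^n) Ff(xi).\<close>
definition frac_heat :: "real \<Rightarrow> ('a::euclidean_space \<Rightarrow> complex) \<Rightarrow> 'a \<Rightarrow> complex" where
  "frac_heat t f x = (\<integral> \<xi>. cis (2 * pi * (x \<bullet> \<xi>)) * complex_of_real (exp (- t * norm \<xi> ^ DIM('a)))
                          * fourier_L2 f \<xi> \<partial>lborel)"

definition cube :: "'a::euclidean_space \<Rightarrow> real \<Rightarrow> 'a set" where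
  "cube a l = cbox a (a + l *\<^sub>R One)"

definition cube_avg :: "('a::euclidean_space \<Rightarrow> complex) \<Rightarrow> 'a set \<Rightarrow> complex" where
  "cube_avg g Q = (LINT x : Q | lborel. g x) / complex_of_real (measure lborel Q)"

definition bmo_sq :: "('a::euclidean_space \<Rightarrow> complex) \<Rightarrow> ennreal" where
  "bmo_sq g = (if \<forall>a l. l > 0 \<longrightarrow> set_integrable lborel (cube a l) g
     then (SUP (a, l) \<in> {(a, l). l > 0}.
             ennreal (1 / l ^ DIM('a)) *
             (\<integral>\<^sup>+ x \<in> cube a l. ennreal ((norm (g x - cube_avg g (cube a l)))\<^sup>2) \<partial>lborel))
     else \<infinity>)"

end

theory Submission
  imports Defs "HOL-Probability.Probability"
begin

text \<open>
  The stronger bound with the supremum norm in place of BMO holds.  With \<open>g\<close> the Fourier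
  transform of \<open>f\<close>, the solution at time \<open>t\<close> is at most
  \<open>M t = \<integral> exp (- t |\<xi>|^n) |g \<xi>| d\<xi>\<close>.  Splitting the integrand with the weight
  \<open>|\<xi>| powr (- n/2)\<close>, Cauchy--Schwarz gives
  \<open>(M t)^2 \<le> (\<integral> exp (- t |\<xi>|^n) |\<xi>| powr (- n/2) d\<xi>) (\<integral> exp (- t |\<xi>|^n) |\<xi>| powr (n/2) |g \<xi>|^2 d\<xi>)\<close>.
  Under \<open>\<xi> \<mapsto> |\<xi>|^n\<close> Lebesgue measure is pushed forward to a multiple of Lebesgue measure on
  the half line, so the first factor is a constant times \<open>t powr (- 1/2)\<close>; integrating the second
  against this weight in \<open>t\<close> cancels \<open>|\<xi>| powr (n/2)\<close>.  What remains is the Plancherel inequality,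
  obtained by inserting a Gaussian weight on the frequency side, whose Fourier transform is a
  nonnegative kernel of mass one.
\<close>

section \<open>The Plancherel inequality on integrable functions\<close>

lemma borel_measurable_cis [measurable]:
  "f \<in> borel_measurable M \<Longrightarrow> (\<lambda>x. cis (f x)) \<in> borel_measurable M"
  by (simp add: cis_conv_exp)

text \<open>The substitution \<open>x \<mapsto> e * x\<close> reduces the integral to the
  characteristic function of the standard normal law at \<open>2 * pi * z / e\<close>. Stating the
  result as a normal density makes its nonnegativity and total mass one immediate.\<close>

lemma gaussian_fourier_real:
  fixes e z :: real assumes e: "e > 0"
  shows "integrable lborel (\<lambda>x. complex_of_real (exp (- (e * x)\<^sup>2 / 2)) * cis (2 * pi * (x * z)))"
    and "(\<integral>x. complex_of_real (exp (- (e * x)\<^sup>2 / 2)) * cis (2 * pi * (x * z)) \<partial>lborel)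
           = complex_of_real (normal_density 0 (e / (2 * pi)) z)"
proof -
  let ?F = "\<lambda>x. complex_of_real (std_normal_density x) * cis (2 * pi * z / e * x)"
  have F: "integrable lborel ?F"
    by (rule Bochner_Integration.integrable_bound[OF integrable_normal_density[where \<mu>=0 and \<sigma>=1]])
       (auto simp: norm_mult)
  \<comment> \<open>The form \<open>0 + e * x\<close> matches the affine substitution rules, with
    translation part 0.\<close>
  have eq: "complex_of_real (exp (- (e * x)\<^sup>2 / 2)) * cis (2 * pi * (x * z))
      = complex_of_real (sqrt (2 * pi)) * ?F (0 + e * x)" for x
    using e by (simp add: std_normal_density_def field_simps)
  show "integrable lborel (\<lambda>x. complex_of_real (exp (- (e * x)\<^sup>2 / 2)) * cis (2 * pi * (x * z)))"
    unfolding eq using lborel_integrable_real_affine[OF F, of e 0] e by simp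
  have "(\<integral>x. ?F x \<partial>lborel) = char std_normal_distribution (2 * pi * z / e)"
    unfolding char_def
    by (subst integral_density) (auto simp: cis_conv_exp scaleR_conv_of_real mult_ac)
  also have "\<dots> = complex_of_real (exp (- ((2 * pi * z / e)^2) / 2))"
    by (simp add: char_std_normal_distribution)
  finally have I: "(\<integral>x. ?F x \<partial>lborel) = complex_of_real (exp (- ((2 * pi * z / e)^2) / 2))" .
  have scale: "(\<integral>x. ?F (0 + e * x) \<partial>lborel) = (\<integral>x. ?F x \<partial>lborel) / e"
    using lborel_integral_real_affine[of e ?F 0] e by (simp add: scaleR_conv_of_real)
  have "(\<integral>x. complex_of_real (exp (- (e * x)\<^sup>2 / 2)) * cis (2 * pi * (x * z)) \<partial>lborel)
      = complex_of_real (sqrt (2 * pi)) * (\<integral>x. ?F (0 + e * x) \<partial>lborel)"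
    unfolding eq by (rule integral_mult_right_zero)
  also have "\<dots> = complex_of_real (sqrt (2 * pi) * exp (- ((2 * pi * z / e)^2) / 2) / e)"
    unfolding scale I by simp
  \<comment> \<open>The factor \<open>sqrt (2 * pi)\<close> undoes the normalisation of
    \<open>std_normal_density\<close> and \<open>1 / e\<close> is the Jacobian; together they
    normalise a Gaussian of deviation \<open>e / (2 * pi)\<close>.\<close>
  also have "sqrt (2 * pi) * exp (- ((2 * pi * z / e)^2) / 2) / e = normal_density 0 (e / (2 * pi)) z"
  proof -
    have "sqrt (2 * pi * (e / (2 * pi))\<^sup>2) = e / sqrt (2 * pi)"
      using e by (simp add: real_sqrt_mult real_sqrt_divide power2_eq_square field_simps)
    moreover have "(2 * pi * z / e)^2 / 2 = z\<^sup>2 / (2 * (e / (2 * pi))\<^sup>2)"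
      using e by (simp add: power2_eq_square field_simps)
    ultimately show ?thesis
      by (simp add: normal_density_def)
  qed
  finally show "(\<integral>x. complex_of_real (exp (- (e * x)\<^sup>2 / 2)) * cis (2 * pi * (x * z)) \<partial>lborel)
           = complex_of_real (normal_density 0 (e / (2 * pi)) z)" .
qed

text \<open>By \<open>lborel_eq\<close>, Lebesgue measure on \<open>'a\<close> is the image of a
  product of one-dimensional Lebesgue measures indexed by \<open>Basis\<close>, so a product of
  functions of single coordinates integrates factor by factor.\<close>

lemma
  fixes k :: "'a::euclidean_space \<Rightarrow> real \<Rightarrow> complex"
  assumes "\<And>b. b \<in> Basis \<Longrightarrow> integrable lborel (k b)"
  shows integrable_lborel_prod: "integrable lborel (\<lambda>x::'a. \<Prod>b\<in>Basis. k b (x \<bullet> b))"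
    and integral_lborel_prod:
      "integral\<^sup>L lborel (\<lambda>x::'a. \<Prod>b\<in>Basis. k b (x \<bullet> b)) = (\<Prod>b\<in>Basis. \<integral>x. k b x \<partial>lborel)"
proof -
  interpret product_sigma_finite "\<lambda>_::'a. lborel :: real measure" ..
  have [measurable]: "k b \<in> borel_measurable borel" if "b \<in> Basis" for b
    using borel_measurable_integrable[OF assms[OF that]] by simp
  show "integrable lborel (\<lambda>x::'a. \<Prod>b\<in>Basis. k b (x \<bullet> b))"
    using product_integrable_prod[of Basis k] assms
    by (subst lborel_eq) (simp add: integrable_distr_eq)
  show "integral\<^sup>L lborel (\<lambda>x::'a. \<Prod>b\<in>Basis. k b (x \<bullet> b)) = (\<Prod>b\<in>Basis. \<integral>x. k b x \<partial>lborel)"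
    using product_integral_prod[of Basis k] assms
    by (subst lborel_eq) (simp add: integral_distr)
qed

lemma cis_sum: "finite A \<Longrightarrow> cis (\<Sum>i\<in>A. f i) = (\<Prod>i\<in>A. cis (f i))"
  by (induction A rule: finite_induct) (auto simp: cis_mult[symmetric])

text \<open>The centred isotropic Gaussian density of deviation \<open>e / (2 * pi)\<close>. The
  product form lets both its mass and its role as a Fourier transform be computed one coordinate at
  a time.\<close>

definition gauss_kernel :: "real \<Rightarrow> 'a::euclidean_space \<Rightarrow> real" where
  "gauss_kernel e z = (\<Prod>b\<in>Basis. normal_density 0 (e / (2 * pi)) (z \<bullet> b))"

lemma gauss_kernel_nonneg: "0 \<le> gauss_kernel e z"
  by (simp add: gauss_kernel_def prod_nonneg)

lemma gauss_kernel_measurable [measurable]: "gauss_kernel e \<in> borel_measurable borel"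
  unfolding gauss_kernel_def by measurable

text \<open>The squared norm and the phase are both sums over coordinates, so the exponentials
  factor and the one-dimensional case applies to each factor.\<close>

lemma gaussian_fourier:
  fixes z :: "'a::euclidean_space" assumes e: "e > 0"
  shows "integrable lborel (\<lambda>x::'a. complex_of_real (exp (- (e * norm x)\<^sup>2 / 2)) * cis (2 * pi * (x \<bullet> z)))"
    and "(\<integral>x. complex_of_real (exp (- (e * norm x)\<^sup>2 / 2)) * cis (2 * pi * (x \<bullet> z)) \<partial>lborel)
           = complex_of_real (gauss_kernel e z)"
proof -
  define k where "k b y = complex_of_real (exp (- (e * y)\<^sup>2 / 2)) * cis (2 * pi * (y * (z \<bullet> b)))" for b y
  have eq: "complex_of_real (exp (- (e * norm x)\<^sup>2 / 2)) * cis (2 * pi * (x \<bullet> z))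
      = (\<Prod>b\<in>Basis. k b (x \<bullet> b))" for x
  proof -
    have "(norm x)\<^sup>2 = (\<Sum>b\<in>Basis. (x \<bullet> b)\<^sup>2)"
      unfolding power2_norm_eq_inner by (subst euclidean_inner) (simp add: power2_eq_square)
    then have "exp (- (e * norm x)\<^sup>2 / 2) = exp (\<Sum>b\<in>Basis. - (e * (x \<bullet> b))\<^sup>2 / 2)"
      by (simp add: power_mult_distrib sum_distrib_left sum_divide_distrib sum_negf)
    moreover have "cis (2 * pi * (x \<bullet> z)) = cis (\<Sum>b\<in>Basis. 2 * pi * ((x \<bullet> b) * (z \<bullet> b)))"
      by (subst euclidean_inner) (simp add: sum_distrib_left)
    ultimately show ?thesis
      by (simp add: k_def exp_sum cis_sum prod.distrib)
  qed
  have k: "integrable lborel (k b)" "integral\<^sup>L lborel (k b) = complex_of_real (normal_density 0 (e / (2 * pi)) (z \<bullet> b))" for b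
    using gaussian_fourier_real[OF e, of "z \<bullet> b"] by (simp_all add: k_def[abs_def])
  show "integrable lborel (\<lambda>x::'a. complex_of_real (exp (- (e * norm x)\<^sup>2 / 2)) * cis (2 * pi * (x \<bullet> z)))"
    unfolding eq by (intro integrable_lborel_prod k)
  show "(\<integral>x. complex_of_real (exp (- (e * norm x)\<^sup>2 / 2)) * cis (2 * pi * (x \<bullet> z)) \<partial>lborel)
           = complex_of_real (gauss_kernel e z)"
    unfolding eq by (subst integral_lborel_prod) (simp_all add: k gauss_kernel_def)
qed

lemma nn_integral_gauss_kernel:
  assumes e: "e > 0"
  shows "(\<integral>\<^sup>+z. ennreal (gauss_kernel e (z::'a::euclidean_space)) \<partial>lborel) = 1"
proof -
  have "(\<integral>\<^sup>+z. ennreal (gauss_kernel e (z::'a)) \<partial>lborel)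
      = (\<integral>\<^sup>+z. (\<Prod>b\<in>Basis. ennreal (normal_density 0 (e / (2 * pi)) ((z::'a) \<bullet> b))) \<partial>lborel)"
    by (simp add: gauss_kernel_def prod_ennreal)
  also have "\<dots> = (\<Prod>b\<in>(Basis::'a set). \<integral>\<^sup>+x. ennreal (normal_density 0 (e / (2 * pi)) x) \<partial>lborel)"
    by (subst nn_integral_lborel_prod) auto
  also have "\<dots> = 1"
    using e by (subst nn_integral_eq_integral) auto
  finally show ?thesis .
qed

text \<open>The Schur argument integrates the kernel once in each of its two variables, hence the
  two orders of the difference. Translation and reflection are the affine maps with
  \<open>c = 1\<close> and \<open>c = -1\<close>, where the Jacobian is 1.\<close>

lemma nn_integral_gauss_kernel_diff:
  fixes x :: "'a::euclidean_space"
  assumes e: "e > 0"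
  shows "(\<integral>\<^sup>+y. ennreal (gauss_kernel e (y - x)) \<partial>lborel) = 1"
    and "(\<integral>\<^sup>+y. ennreal (gauss_kernel e (x - y)) \<partial>lborel) = 1"
proof -
  have *: "(\<integral>\<^sup>+y. ennreal (gauss_kernel e (t + c *\<^sub>R y)) \<partial>lborel) = 1" if "\<bar>c\<bar> = 1" for t :: 'a and c
  proof -
    have "1 = (\<integral>\<^sup>+y. ennreal (gauss_kernel e y) \<partial>density (distr lborel borel (\<lambda>x::'a. t + c *\<^sub>R x)) (\<lambda>_. \<bar>c\<bar>^DIM('a)))"
      using that by (subst lborel_affine[symmetric]) (auto simp: nn_integral_gauss_kernel[OF e])
    then show ?thesis
      using that by (simp add: nn_integral_density nn_integral_distr)
  qed
  show "(\<integral>\<^sup>+y. ennreal (gauss_kernel e (y - x)) \<partial>lborel) = 1"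
    using *[of 1 "- x"] by simp
  show "(\<integral>\<^sup>+y. ennreal (gauss_kernel e (x - y)) \<partial>lborel) = 1"
    using *[of "-1" "x"] by simp
qed

section \<open>Plancherel inequality by Gaussian damping\<close>

definition fourier_L1 :: "('a::euclidean_space \<Rightarrow> complex) \<Rightarrow> 'a \<Rightarrow> complex" where
  "fourier_L1 f \<xi> = (\<integral>x. f x * cis (- 2 * pi * (x \<bullet> \<xi>)) \<partial>lborel)"

lemma fourier_L1_measurable [measurable]:
  assumes [measurable]: "f \<in> borel_measurable borel"
  shows "fourier_L1 f \<in> borel_measurable borel"
proof -
  have "(\<lambda>\<xi>. \<integral>x. f x * cis (- 2 * pi * (x \<bullet> \<xi>)) \<partial>lborel) \<in> borel_measurable borel"
    by (rule lborel.borel_measurable_lebesgue_integral) measurable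
  then show ?thesis by (simp add: fourier_L1_def[abs_def])
qed

lemma integrable_pair_mult:
  fixes f :: "'a \<Rightarrow> complex" and g :: "'b \<Rightarrow> complex"
  assumes "sigma_finite_measure M1" "sigma_finite_measure M2"
  assumes f: "integrable M1 f" and g: "integrable M2 g"
  shows "integrable (M1 \<Otimes>\<^sub>M M2) (\<lambda>p. f (fst p) * g (snd p))"
proof -
  interpret M1: sigma_finite_measure M1 by fact
  interpret M2: sigma_finite_measure M2 by fact
  interpret pair_sigma_finite M1 M2 ..
  have [measurable]: "f \<in> borel_measurable M1" "g \<in> borel_measurable M2"
    using f g by auto
  show ?thesis
    using f g by (intro Fubini_integrable) (auto simp: norm_mult)
qed

text \<open>Expand the square of the transform as a double integral in \<open>x\<close> and
  \<open>y\<close> and integrate in \<xi> first: the weight makes the triple integrand absolutely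
  integrable, so Fubini applies, and the \<xi>-integral is the kernel at \<open>y - x\<close>. The
  inequality enters when absolute values are taken inside the remaining double integral.\<close>

lemma fourier_L1_gaussian_weight:
  fixes f :: "'a::euclidean_space \<Rightarrow> complex"
  assumes f: "integrable lborel f" and e: "e > 0"
  shows "(\<integral>\<^sup>+\<xi>. ennreal (exp (- (e * norm \<xi>)\<^sup>2 / 2) * (norm (fourier_L1 f \<xi>))\<^sup>2) \<partial>lborel)
      \<le> (\<integral>\<^sup>+p. ennreal (norm (f (fst p)) * norm (f (snd p)) * gauss_kernel e (snd p - fst p)) \<partial>(lborel \<Otimes>\<^sub>M lborel))"
proof -
  have [measurable]: "f \<in> borel_measurable borel"
    using borel_measurable_integrable[OF f] by simp
  let ?P = "lborel \<Otimes>\<^sub>M lborel :: ('a \<times> 'a) measure"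
  have sP: "sigma_finite_measure ?P" unfolding lborel_prod by (rule lborel.sigma_finite_measure_axioms)
  interpret PP: pair_sigma_finite ?P "lborel :: 'a measure"
    by (intro pair_sigma_finite.intro sP) standard
  define K :: "'a \<Rightarrow> complex" where "K \<xi> = complex_of_real (exp (- (e * norm \<xi>)\<^sup>2 / 2))" for \<xi>
  have [measurable]: "K \<in> borel_measurable borel" unfolding K_def by measurable
  have K: "integrable lborel K"
    using gaussian_fourier(1)[OF e, of "0::'a"] by (simp add: K_def[abs_def])
  have ff: "integrable ?P (\<lambda>p. f (fst p) * cnj (f (snd p)))"
    by (intro integrable_pair_mult) (auto intro: f lborel.sigma_finite_measure_axioms)
  have [measurable]: "cnj \<in> borel_measurable borel"
    by (intro borel_measurable_continuous_onI continuous_intros)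
  \<comment> \<open>With \<open>p = (x, y)\<close>, the phase at \<open>x\<close> times the
    conjugate phase at \<open>y\<close> is
    \<open>cis (2 * pi * (\<xi> \<bullet> (y - x)))\<close>.\<close>
  define H where "H p \<xi> = f (fst p) * cnj (f (snd p)) * (K \<xi> * cis (2 * pi * (\<xi> \<bullet> (snd p - fst p))))" for p \<xi>
  have H: "integrable (?P \<Otimes>\<^sub>M lborel) (case_prod H)"
  proof (rule Bochner_Integration.integrable_bound)
    show "integrable (?P \<Otimes>\<^sub>M lborel) (\<lambda>q. (f (fst (fst q)) * cnj (f (snd (fst q)))) * K (snd q))"
      by (rule integrable_pair_mult[OF sP lborel.sigma_finite_measure_axioms ff K])
  qed (auto simp: H_def norm_mult split_beta' )
  have inner1: "(\<integral>\<xi>. H p \<xi> \<partial>lborel) = f (fst p) * cnj (f (snd p)) * complex_of_real (gauss_kernel e (snd p - fst p))" for p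
    unfolding H_def K_def using gaussian_fourier(2)[OF e, of "snd p - fst p"] by simp
  have inner2: "(\<integral>p. H p \<xi> \<partial>?P) = complex_of_real (exp (- (e * norm \<xi>)\<^sup>2 / 2) * (norm (fourier_L1 f \<xi>))\<^sup>2)" for \<xi>
  proof -
    let ?g = "\<lambda>x. f x * cis (- 2 * pi * (x \<bullet> \<xi>))"
    have g: "integrable lborel ?g"
      by (rule Bochner_Integration.integrable_bound[OF f]) (auto simp: norm_mult)
    have gg: "integrable ?P (\<lambda>p. ?g (fst p) * cnj (?g (snd p)))"
      using g integrable_cnj[OF g] by (intro integrable_pair_mult lborel.sigma_finite_measure_axioms)
    have "H p \<xi> = K \<xi> * (?g (fst p) * cnj (?g (snd p)))" for p
    proof -
      have "cis (2 * pi * (\<xi> \<bullet> (snd p - fst p))) = cis (- 2 * pi * (fst p \<bullet> \<xi>)) * cnj (cis (- 2 * pi * (snd p \<bullet> \<xi>)))"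
        by (simp add: cis_cnj cis_mult inner_diff_right inner_commute right_diff_distrib)
      then show ?thesis unfolding H_def by simp
    qed
    then have "(\<integral>p. H p \<xi> \<partial>?P) = K \<xi> * (\<integral>p. ?g (fst p) * cnj (?g (snd p)) \<partial>?P)"
      by simp
    also have "(\<integral>p. ?g (fst p) * cnj (?g (snd p)) \<partial>?P) = (\<integral>x. (\<integral>y. ?g x * cnj (?g y) \<partial>lborel) \<partial>lborel)"
      using lborel_pair.integral_fst'[OF gg] by simp
    also have "\<dots> = fourier_L1 f \<xi> * cnj (fourier_L1 f \<xi>)"
      unfolding integral_mult_right_zero integral_mult_left_zero Bochner_Integration.integral_cnj fourier_L1_def ..
    finally show ?thesis
      by (simp add: K_def complex_norm_square[symmetric])
  qed
  \<comment> \<open>Integrability of the damped square comes out of Fubini, since this function is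
    the partial integral of \<open>H\<close> over \<open>p\<close>.\<close>
  have int: "integrable lborel (\<lambda>\<xi>. exp (- (e * norm \<xi>)\<^sup>2 / 2) * (norm (fourier_L1 f \<xi>))\<^sup>2)"
    using PP.integrable_snd[OF H] unfolding inner2 complex_of_real_integrable_eq .
  have "(\<integral>\<^sup>+\<xi>. ennreal (exp (- (e * norm \<xi>)\<^sup>2 / 2) * (norm (fourier_L1 f \<xi>))\<^sup>2) \<partial>lborel)
      = ennreal (\<integral>\<xi>. exp (- (e * norm \<xi>)\<^sup>2 / 2) * (norm (fourier_L1 f \<xi>))\<^sup>2 \<partial>lborel)"
    by (rule nn_integral_eq_integral[OF int]) simp
  also have "\<dots> = ennreal (norm (\<integral>\<xi>. (\<integral>p. H p \<xi> \<partial>?P) \<partial>lborel))"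
    unfolding inner2 integral_complex_of_real by (simp add: integral_nonneg_AE)
  also have "\<dots> = ennreal (norm (\<integral>p. (\<integral>\<xi>. H p \<xi> \<partial>lborel) \<partial>?P))"
    using PP.Fubini_integral[OF H] by simp
  also have "\<dots> \<le> (\<integral>\<^sup>+p. norm (f (fst p) * cnj (f (snd p)) * complex_of_real (gauss_kernel e (snd p - fst p))) \<partial>?P)"
    unfolding inner1
    by (rule integral_norm_bound_ennreal) (use PP.integrable_fst[OF H] in \<open>simp add: inner1\<close>)
  also have "\<dots> = (\<integral>\<^sup>+p. ennreal (norm (f (fst p)) * norm (f (snd p)) * gauss_kernel e (snd p - fst p)) \<partial>?P)"
    by (simp add: norm_mult gauss_kernel_nonneg)
  finally show ?thesis .
qed

text \<open>Schur test: \<open>a * b \<le> a^2 / 2 + b^2 / 2\<close> separates the two values of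
  \<open>f\<close>, and the kernel has mass one in either variable. The resulting bound does not
  depend on \<open>e\<close>.\<close>

lemma gauss_kernel_schur:
  fixes f :: "'a::euclidean_space \<Rightarrow> complex"
  assumes [measurable]: "f \<in> borel_measurable borel" and e: "e > 0"
  shows "(\<integral>\<^sup>+p. ennreal (norm (f (fst p)) * norm (f (snd p)) * gauss_kernel e (snd p - fst p)) \<partial>(lborel \<Otimes>\<^sub>M lborel))
     \<le> (\<integral>\<^sup>+x. ennreal ((norm (f x))\<^sup>2) \<partial>lborel)"
proof -
  let ?P = "lborel \<Otimes>\<^sub>M lborel :: ('a \<times> 'a) measure"
  define h where "h x = ennreal ((norm (f x))\<^sup>2 / 2)" for x
  have [measurable]: "h \<in> borel_measurable borel" unfolding h_def by measurable
  have "(\<integral>\<^sup>+p. ennreal (norm (f (fst p)) * norm (f (snd p)) * gauss_kernel e (snd p - fst p)) \<partial>?P)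
     \<le> (\<integral>\<^sup>+p. h (fst p) * ennreal (gauss_kernel e (snd p - fst p)) + h (snd p) * ennreal (gauss_kernel e (snd p - fst p)) \<partial>?P)"
  proof (rule nn_integral_mono)
    fix p :: "'a \<times> 'a"
    have "norm (f (fst p)) * norm (f (snd p)) \<le> (norm (f (fst p)))\<^sup>2 / 2 + (norm (f (snd p)))\<^sup>2 / 2"
      using sum_squares_bound[of "norm (f (fst p))" "norm (f (snd p))"] by simp
    then have "norm (f (fst p)) * norm (f (snd p)) * gauss_kernel e (snd p - fst p)
        \<le> ((norm (f (fst p)))\<^sup>2 / 2 + (norm (f (snd p)))\<^sup>2 / 2) * gauss_kernel e (snd p - fst p)"
      by (intro mult_right_mono gauss_kernel_nonneg)
    then have "ennreal (norm (f (fst p)) * norm (f (snd p)) * gauss_kernel e (snd p - fst p))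
        \<le> ennreal (((norm (f (fst p)))\<^sup>2 / 2 + (norm (f (snd p)))\<^sup>2 / 2) * gauss_kernel e (snd p - fst p))"
      by (rule ennreal_leI)
    also have "\<dots> = h (fst p) * ennreal (gauss_kernel e (snd p - fst p)) + h (snd p) * ennreal (gauss_kernel e (snd p - fst p))"
      unfolding h_def by (simp add: distrib_right gauss_kernel_nonneg flip: ennreal_mult)
    finally show "ennreal (norm (f (fst p)) * norm (f (snd p)) * gauss_kernel e (snd p - fst p))
        \<le> h (fst p) * ennreal (gauss_kernel e (snd p - fst p)) + h (snd p) * ennreal (gauss_kernel e (snd p - fst p))" .
  qed
  also have "\<dots> = (\<integral>\<^sup>+p. h (fst p) * ennreal (gauss_kernel e (snd p - fst p)) \<partial>?P)
      + (\<integral>\<^sup>+p. h (snd p) * ennreal (gauss_kernel e (snd p - fst p)) \<partial>?P)"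
    by (rule nn_integral_add) measurable
  also have "(\<integral>\<^sup>+p. h (fst p) * ennreal (gauss_kernel e (snd p - fst p)) \<partial>?P) = (\<integral>\<^sup>+x. h x \<partial>lborel)"
    by (subst lborel.nn_integral_fst[symmetric])
       (simp_all add: nn_integral_cmult nn_integral_gauss_kernel_diff[OF e])
  also have "(\<integral>\<^sup>+p. h (snd p) * ennreal (gauss_kernel e (snd p - fst p)) \<partial>?P) = (\<integral>\<^sup>+x. h x \<partial>lborel)"
    by (subst lborel_pair.nn_integral_snd[symmetric])
       (simp_all add: nn_integral_cmult nn_integral_gauss_kernel_diff[OF e])
  also have "(\<integral>\<^sup>+x. h x \<partial>lborel) + (\<integral>\<^sup>+x. h x \<partial>lborel) = (\<integral>\<^sup>+x. ennreal ((norm (f x))\<^sup>2) \<partial>lborel)"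
    by (subst nn_integral_add[symmetric]) (auto simp: h_def simp flip: ennreal_plus)
  finally show ?thesis .
qed

text \<open>The two preceding bounds are uniform in \<open>e\<close>, so Fatou's lemma removes the
  weight along \<open>e = 1 / (n + 1)\<close>. The right-hand side may be infinite.\<close>

lemma plancherel_L1_le:
  fixes f :: "'a::euclidean_space \<Rightarrow> complex"
  assumes f: "integrable lborel f"
  shows "(\<integral>\<^sup>+\<xi>. ennreal ((norm (fourier_L1 f \<xi>))\<^sup>2) \<partial>lborel) \<le> (\<integral>\<^sup>+x. ennreal ((norm (f x))\<^sup>2) \<partial>lborel)"
proof -
  have [measurable]: "f \<in> borel_measurable borel"
    using borel_measurable_integrable[OF f] by simp
  define u where "u n \<xi> = ennreal (exp (- (inverse (real (Suc n)) * norm \<xi>)\<^sup>2 / 2) * (norm (fourier_L1 f \<xi>))\<^sup>2)" for n \<xi>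
  have [measurable]: "u n \<in> borel_measurable borel" for n unfolding u_def by measurable
  have "(\<lambda>n. u n \<xi>) \<longlonglongrightarrow> ennreal (exp (- (0 * norm \<xi>)\<^sup>2 / 2) * (norm (fourier_L1 f \<xi>))\<^sup>2)" for \<xi>
    unfolding u_def by (intro tendsto_intros tendsto_ennrealI LIMSEQ_inverse_real_of_nat) auto
  then have lim: "liminf (\<lambda>n. u n \<xi>) = ennreal ((norm (fourier_L1 f \<xi>))\<^sup>2)" for \<xi>
    using lim_imp_Liminf[OF sequentially_bot] by fastforce
  have "(\<integral>\<^sup>+\<xi>. ennreal ((norm (fourier_L1 f \<xi>))\<^sup>2) \<partial>lborel) = (\<integral>\<^sup>+\<xi>. liminf (\<lambda>n. u n \<xi>) \<partial>lborel)"
    by (simp add: lim)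
  also have "\<dots> \<le> liminf (\<lambda>n. \<integral>\<^sup>+\<xi>. u n \<xi> \<partial>lborel)"
    by (rule nn_integral_liminf) simp
  also have "\<dots> \<le> limsup (\<lambda>n. \<integral>\<^sup>+\<xi>. u n \<xi> \<partial>lborel)"
    by (rule Liminf_le_Limsup) simp
  also have "\<dots> \<le> (\<integral>\<^sup>+x. ennreal ((norm (f x))\<^sup>2) \<partial>lborel)"
  proof (rule Limsup_bounded[OF always_eventually], rule allI)
    fix n
    show "(\<integral>\<^sup>+\<xi>. u n \<xi> \<partial>lborel) \<le> (\<integral>\<^sup>+x. ennreal ((norm (f x))\<^sup>2) \<partial>lborel)"
      unfolding u_def
      by (rule order_trans[OF fourier_L1_gaussian_weight[OF f] gauss_kernel_schur]) auto
  qed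
  finally show ?thesis .
qed

section \<open>The Fourier transform on square integrable functions\<close>

text \<open>A bounded set has finite measure, and there \<open>1 + |f|^2\<close> is an integrable
  majorant of \<open>|f|\<close>. This brings truncations of \<open>f\<close> within reach of
  \<open>plancherel_L1_le\<close>.\<close>

lemma L2_mult_indicator_integrable:
  fixes f :: "'a::euclidean_space \<Rightarrow> complex"
  assumes f: "f \<in> L2" and [measurable]: "A \<in> sets borel" and A: "bounded A"
  shows "integrable lborel (\<lambda>x. indicator A x *\<^sub>R f x)"
proof (rule Bochner_Integration.integrable_bound)
  have "emeasure lborel A < \<infinity>" by (rule emeasure_bounded_finite[OF A])
  then show "integrable lborel (\<lambda>x. indicator A x + (norm (f x))\<^sup>2)"
    using f by (auto simp: L2_def)
  have "norm (f x) \<le> 1 + (norm (f x))\<^sup>2" for x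
    using sum_squares_bound[of 1 "norm (f x)"] norm_ge_zero[of "f x"] by (simp only: power_one)
  then show "AE x in lborel. norm (indicator A x *\<^sub>R f x) \<le> norm (indicator A x + (norm (f x))\<^sup>2)"
    by (auto simp: indicator_def)
qed (use f in \<open>auto simp: L2_def\<close>)

lemma trunc_fourier_eq: "trunc_fourier R f = fourier_L1 (\<lambda>x. indicator (ball 0 R) x *\<^sub>R f x)"
  by (simp add: fun_eq_iff trunc_fourier_def fourier_L1_def set_lebesgue_integral_def)

lemma trunc_fourier_measurable:
  assumes "f \<in> L2"
  shows "trunc_fourier R f \<in> borel_measurable borel"
proof -
  have [measurable]: "f \<in> borel_measurable borel" using assms by (simp add: L2_def)
  show ?thesis unfolding trunc_fourier_eq
    by (intro fourier_L1_measurable borel_measurable_scaleR borel_measurable_indicator) auto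
qed

lemma fourier_L1_diff:
  assumes "integrable lborel f" "integrable lborel g"
  shows "fourier_L1 f \<xi> - fourier_L1 g \<xi> = fourier_L1 (\<lambda>x. f x - g x) \<xi>"
proof -
  have "integrable lborel (\<lambda>x. h x * cis (- 2 * pi * (x \<bullet> \<xi>)))" if "integrable lborel h" for h :: "'a \<Rightarrow> complex"
    using borel_measurable_integrable[OF that]
    by (intro Bochner_Integration.integrable_bound[OF that]) (auto simp: norm_mult)
  then show ?thesis
    using assms by (simp add: fourier_L1_def left_diff_distrib)
qed

definition L2_tail :: "('a::euclidean_space \<Rightarrow> complex) \<Rightarrow> real \<Rightarrow> ennreal" where
  "L2_tail f R = (\<integral>\<^sup>+x. ennreal ((norm (f x))\<^sup>2) * indicator (- ball 0 R) x \<partial>lborel)"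

text \<open>The difference is, up to sign, the transform of \<open>f\<close> restricted to a shell
  outside \<open>ball 0 R\<close>. Thus \<open>L2_tail f R\<close> is a Cauchy modulus for the
  truncated transforms, uniform in \<open>S\<close>.\<close>

lemma trunc_fourier_diff_le:
  fixes f :: "'a::euclidean_space \<Rightarrow> complex"
  assumes f: "f \<in> L2" and "R \<le> S"
  shows "(\<integral>\<^sup>+\<xi>. ennreal ((norm (trunc_fourier R f \<xi> - trunc_fourier S f \<xi>))\<^sup>2) \<partial>lborel) \<le> L2_tail f R"
proof -
  let ?c = "\<lambda>r x. indicator (ball 0 r) x *\<^sub>R f x"
  have i: "integrable lborel (?c r)" for r
    by (rule L2_mult_indicator_integrable[OF f]) auto
  have "(\<integral>\<^sup>+\<xi>. ennreal ((norm (trunc_fourier R f \<xi> - trunc_fourier S f \<xi>))\<^sup>2) \<partial>lborel)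
     \<le> (\<integral>\<^sup>+x. ennreal ((norm (?c R x - ?c S x))\<^sup>2) \<partial>lborel)"
    unfolding trunc_fourier_eq fourier_L1_diff[OF i i]
    by (rule plancherel_L1_le) (intro Bochner_Integration.integrable_diff i)
  also have "\<dots> \<le> L2_tail f R"
    unfolding L2_tail_def using \<open>R \<le> S\<close> by (intro nn_integral_mono) (auto simp: indicator_def)
  finally show ?thesis .
qed

lemma trunc_fourier_le:
  assumes f: "f \<in> L2"
  shows "(\<integral>\<^sup>+\<xi>. ennreal ((norm (trunc_fourier R f \<xi>))\<^sup>2) \<partial>lborel) \<le> (\<integral>\<^sup>+x. ennreal ((norm (f x))\<^sup>2) \<partial>lborel)"
proof -
  have "(\<integral>\<^sup>+\<xi>. ennreal ((norm (trunc_fourier R f \<xi>))\<^sup>2) \<partial>lborel)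
     \<le> (\<integral>\<^sup>+x. ennreal ((norm (indicator (ball 0 R) x *\<^sub>R f x))\<^sup>2) \<partial>lborel)"
    unfolding trunc_fourier_eq
    by (rule plancherel_L1_le) (rule L2_mult_indicator_integrable[OF f], auto)
  also have "\<dots> \<le> (\<integral>\<^sup>+x. ennreal ((norm (f x))\<^sup>2) \<partial>lborel)"
    by (intro nn_integral_mono) (auto simp: indicator_def)
  finally show ?thesis .
qed

lemma L2_nn_integral_finite:
  "f \<in> L2 \<Longrightarrow> (\<integral>\<^sup>+x. ennreal ((norm (f x))\<^sup>2) \<partial>lborel) < \<infinity>"
  by (auto simp: L2_def integrable_iff_bounded)

lemma L2_tail_tendsto:
  fixes f :: "'a::euclidean_space \<Rightarrow> complex"
  assumes f: "f \<in> L2"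
  shows "(L2_tail f \<longlongrightarrow> 0) at_top"
proof -
  have [measurable]: "f \<in> borel_measurable borel" using f by (simp add: L2_def)
  have anti: "L2_tail f S \<le> L2_tail f R" if "R \<le> S" for R S
    unfolding L2_tail_def using that by (intro nn_integral_mono) (auto simp: indicator_def)
  have "(\<lambda>n. L2_tail f (real n)) \<longlonglongrightarrow> (\<integral>\<^sup>+x. 0 \<partial>(lborel :: 'a measure))"
    unfolding L2_tail_def
  proof (rule nn_integral_dominated_convergence[where w = "\<lambda>x. ennreal ((norm (f x))\<^sup>2)"])
    show "AE x in lborel. (\<lambda>i. ennreal ((norm (f x))\<^sup>2) * indicator (- ball 0 (real i)) x) \<longlonglongrightarrow> 0"
    proof (rule AE_I2)
      fix x :: 'a
      have "\<forall>\<^sub>F i in sequentially. norm x < real i"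
        using filterlim_real_sequentially by (simp add: filterlim_at_top_dense)
      then have "\<forall>\<^sub>F i in sequentially. ennreal ((norm (f x))\<^sup>2) * indicator (- ball 0 (real i)) x = 0"
        by eventually_elim auto
      then show "(\<lambda>i. ennreal ((norm (f x))\<^sup>2) * indicator (- ball 0 (real i)) x) \<longlonglongrightarrow> 0"
        by (rule tendsto_eventually)
    qed
  qed (use L2_nn_integral_finite[OF f] in \<open>auto simp: indicator_def\<close>)
  then have lim: "(\<lambda>n. L2_tail f (real n)) \<longlonglongrightarrow> 0" by simp
  \<comment> \<open>Dominated convergence gave the limit along integers; monotonicity of the tail
    extends it to all real radii.\<close>
  show ?thesis
  proof (rule order_tendstoI)
    fix a :: ennreal assume "0 < a"
    then obtain n where n: "L2_tail f (real n) < a"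
      using order_tendstoD(2)[OF lim] eventually_happens'[OF sequentially_bot] by blast
    then show "\<forall>\<^sub>F R in at_top. L2_tail f R < a"
      unfolding eventually_at_top_linorder using anti by (intro exI[of _ "real n"]) (meson order_le_less_trans)
  qed simp
qed

text \<open>The pointwise part of Riesz-Fischer. Increments of squared norm at most
  \<open>(1/4) ^ k\<close> stay summable after weighting by \<open>2 ^ k\<close>, so the weighted
  sum of squares is finite almost everywhere.\<close>

lemma AE_convergent_of_L2_summable:
  fixes h :: "nat \<Rightarrow> 'a \<Rightarrow> 'b::{banach, second_countable_topology}"
  assumes [measurable]: "\<And>k. h k \<in> borel_measurable M"
    and le: "\<And>k. (\<integral>\<^sup>+x. ennreal ((norm (h (Suc k) x - h k x))\<^sup>2) \<partial>M) \<le> ennreal ((1/4) ^ k)"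
  shows "AE x in M. convergent (\<lambda>k. h k x)"
proof -
  define d where "d k x = norm (h (Suc k) x - h k x)" for k x
  have [measurable]: "d k \<in> borel_measurable M" for k unfolding d_def by measurable
  have "(\<integral>\<^sup>+x. (\<Sum>k. ennreal (2 ^ k * (d k x)\<^sup>2)) \<partial>M) = (\<Sum>k. \<integral>\<^sup>+x. ennreal (2 ^ k * (d k x)\<^sup>2) \<partial>M)"
    by (rule nn_integral_suminf) measurable
  also have "\<dots> \<le> (\<Sum>k. ennreal ((1/2) ^ k))"
  proof (rule suminf_le)
    fix k
    have "(\<integral>\<^sup>+x. ennreal (2 ^ k * (d k x)\<^sup>2) \<partial>M) = ennreal (2 ^ k) * (\<integral>\<^sup>+x. ennreal ((d k x)\<^sup>2) \<partial>M)"
      by (subst nn_integral_cmult[symmetric]) (auto simp: ennreal_mult)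
    also have "\<dots> \<le> ennreal (2 ^ k) * ennreal ((1/4) ^ k)"
      unfolding d_def by (intro mult_left_mono le) simp
    also have "\<dots> = ennreal ((1/2) ^ k)"
      by (simp add: power_mult_distrib[symmetric] flip: ennreal_mult)
    finally show "(\<integral>\<^sup>+x. ennreal (2 ^ k * (d k x)\<^sup>2) \<partial>M) \<le> ennreal ((1/2) ^ k)" .
  qed auto
  also have "\<dots> < \<infinity>"
    by (subst suminf_ennreal2) (auto intro: summable_geometric)
  finally have "AE x in M. (\<Sum>k. ennreal (2 ^ k * (d k x)\<^sup>2)) \<noteq> \<infinity>"
    by (intro nn_integral_PInf_AE) auto
  then show ?thesis
  proof eventually_elim
    fix x assume "(\<Sum>k. ennreal (2 ^ k * (d k x)\<^sup>2)) \<noteq> \<infinity>"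
    then have s: "summable (\<lambda>k. 2 ^ k * (d k x)\<^sup>2)"
      by (intro summable_suminf_not_top) auto
    have "summable (\<lambda>k. d k x)"
    proof (rule summable_comparison_test')
      show "summable (\<lambda>k. (1/2) ^ k + 2 ^ k * (d k x)\<^sup>2)"
        by (intro summable_add s summable_geometric) simp
      fix k :: nat
      \<comment> \<open>Completing the square turns weighted square summability into plain
        summability of \<open>d k x\<close>, at the cost of a geometric series.\<close>
      have "2 ^ k * (d k x)\<^sup>2 + (1/2) ^ k - 2 * d k x = 2 ^ k * (d k x - (1/2) ^ k)\<^sup>2"
        by (simp add: power2_eq_square algebra_simps power_one_over)
      also have "\<dots> \<ge> 0" by simp
      finally have "2 * d k x \<le> (1/2) ^ k + 2 ^ k * (d k x)\<^sup>2" by simp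
      moreover have "0 \<le> d k x" by (simp add: d_def)
      ultimately show "norm (d k x) \<le> (1/2) ^ k + 2 ^ k * (d k x)\<^sup>2" by simp
    qed
    then have "summable (\<lambda>k. h (Suc k) x - h k x)"
      unfolding d_def by (rule summable_norm_cancel)
    then have "convergent (\<lambda>n. \<Sum>k<n. h (Suc k) x - h k x)"
      by (simp add: summable_iff_convergent)
    then have "convergent (\<lambda>n. h n x - h 0 x)"
      by (simp only: sum_lessThan_telescope[of "\<lambda>k. h k x"])
    then obtain L where "(\<lambda>n. h n x - h 0 x) \<longlonglongrightarrow> L"
      by (auto simp: convergent_def)
    from tendsto_add[OF this tendsto_const[of "h 0 x"]] show "convergent (\<lambda>k. h k x)"
      by (auto simp: convergent_def)
  qed
qed

text \<open>This gives the choice in \<open>fourier_L2\<close> its content. The limit is built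
  pointwise along a rapidly converging sequence of radii; Fatou's lemma then yields membership in
  \<open>L2\<close> and convergence along all radii.\<close>

lemma fourier_L2_exists:
  fixes f :: "'a::euclidean_space \<Rightarrow> complex"
  assumes f: "f \<in> L2"
  shows "\<exists>g. g \<in> L2 \<and>
     ((\<lambda>R. \<integral>\<^sup>+ \<xi>. ennreal ((norm (trunc_fourier R f \<xi> - g \<xi>))\<^sup>2) \<partial>lborel) \<longlongrightarrow> 0) at_top"
proof -
  have "\<exists>R\<ge>r. L2_tail f R \<le> ennreal ((1/4) ^ k)" for k r
  proof -
    have "\<forall>\<^sub>F R in at_top. L2_tail f R < ennreal ((1/4) ^ k)"
      by (rule order_tendstoD(2)[OF L2_tail_tendsto[OF f]]) simp
    then have "\<forall>\<^sub>F R in at_top. R \<ge> r \<and> L2_tail f R < ennreal ((1/4) ^ k)"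
      using eventually_ge_at_top[of r] by eventually_elim auto
    from eventually_happens'[OF _ this] show ?thesis by (auto intro: less_imp_le)
  qed
  then have "\<exists>\<rho>. \<forall>k r. \<rho> k r \<ge> r \<and> L2_tail f (\<rho> k r) \<le> ennreal ((1/4) ^ k)"
    by (intro choice allI)
  then obtain \<rho> where \<rho>: "\<And>k r. \<rho> k r \<ge> r" "\<And>k r. L2_tail f (\<rho> k r) \<le> ennreal ((1/4) ^ k)"
    by blast
  \<comment> \<open>The recursion asks for a radius beyond the previous one plus 1, so the radii
    increase to infinity while each meets its own tail bound.\<close>
  define r where "r = rec_nat (\<rho> 0 0) (\<lambda>k s. \<rho> (Suc k) (s + 1))"
  have r_Suc: "r (Suc k) \<ge> r k + 1" for k
    using \<rho>(1) by (simp add: r_def)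
  have r_ge: "r k \<ge> real k" for k
  proof (induction k)
    case 0 show ?case using \<rho>(1)[of 0 0] by (simp add: r_def)
  next
    case (Suc k) then show ?case using r_Suc[of k] by simp
  qed
  have r_tail: "L2_tail f (r k) \<le> ennreal ((1/4) ^ k)" for k
    by (cases k) (auto simp: r_def intro: \<rho>(2)[of 0, simplified] \<rho>(2)[of "Suc _", simplified])
  define h where "h k = trunc_fourier (r k) f" for k
  have [measurable]: "trunc_fourier R f \<in> borel_measurable borel" for R
    by (rule trunc_fourier_measurable[OF f])
  have [measurable]: "h k \<in> borel_measurable borel" for k unfolding h_def by measurable
  have conv: "AE x in lborel. convergent (\<lambda>k. h k x)"
  proof (rule AE_convergent_of_L2_summable)
    fix k
    have "(\<integral>\<^sup>+x. ennreal ((norm (h (Suc k) x - h k x))\<^sup>2) \<partial>lborel) = (\<integral>\<^sup>+x. ennreal ((norm (h k x - h (Suc k) x))\<^sup>2) \<partial>lborel)"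
      by (simp add: norm_minus_commute)
    also have "\<dots> \<le> L2_tail f (r k)"
      unfolding h_def using r_Suc[of k] by (intro trunc_fourier_diff_le[OF f]) simp
    also note r_tail
    finally show "(\<integral>\<^sup>+x. ennreal ((norm (h (Suc k) x - h k x))\<^sup>2) \<partial>lborel) \<le> ennreal ((1/4) ^ k)" .
  qed simp
  define g where "g x = lim (\<lambda>k. h k x)" for x
  have [measurable]: "g \<in> borel_measurable borel"
    unfolding g_def by (rule borel_measurable_lim_metric) simp
  \<comment> \<open>Used twice: \<open>a = 0\<close> shows that \<open>g\<close> lies in
    \<open>L2\<close>, and \<open>a = trunc_fourier R f\<close> bounds the distance to the
    limit.\<close>
  have fatou: "(\<integral>\<^sup>+x. ennreal ((norm (a x - g x))\<^sup>2) \<partial>lborel) \<le> B"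
    if [measurable]: "a \<in> borel_measurable borel" and
      B: "\<forall>\<^sub>F k in sequentially. (\<integral>\<^sup>+x. ennreal ((norm (a x - h k x))\<^sup>2) \<partial>lborel) \<le> B" for a B
  proof -
    have "(\<integral>\<^sup>+x. ennreal ((norm (a x - g x))\<^sup>2) \<partial>lborel) = (\<integral>\<^sup>+x. liminf (\<lambda>k. ennreal ((norm (a x - h k x))\<^sup>2)) \<partial>lborel)"
    proof (rule nn_integral_cong_AE, use conv in eventually_elim)
      fix x assume "convergent (\<lambda>k. h k x)"
      then have "(\<lambda>k. h k x) \<longlonglongrightarrow> g x"
        by (simp add: convergent_LIMSEQ_iff g_def)
      then have "(\<lambda>k. ennreal ((norm (a x - h k x))\<^sup>2)) \<longlonglongrightarrow> ennreal ((norm (a x - g x))\<^sup>2)"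
        by (intro tendsto_ennrealI tendsto_intros)
      then show "ennreal ((norm (a x - g x))\<^sup>2) = liminf (\<lambda>k. ennreal ((norm (a x - h k x))\<^sup>2))"
        using lim_imp_Liminf[OF sequentially_bot] by fastforce
    qed
    also have "\<dots> \<le> liminf (\<lambda>k. \<integral>\<^sup>+x. ennreal ((norm (a x - h k x))\<^sup>2) \<partial>lborel)"
      by (rule nn_integral_liminf) measurable
    also have "\<dots> \<le> limsup (\<lambda>k. \<integral>\<^sup>+x. ennreal ((norm (a x - h k x))\<^sup>2) \<partial>lborel)"
      by (rule Liminf_le_Limsup) simp
    also have "\<dots> \<le> B" by (rule Limsup_bounded[OF B])
    finally show ?thesis .
  qed
  have "(\<integral>\<^sup>+x. ennreal ((norm (0 - g x))\<^sup>2) \<partial>lborel) \<le> (\<integral>\<^sup>+x. ennreal ((norm (f x))\<^sup>2) \<partial>lborel)"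
    by (rule fatou) (use trunc_fourier_le[OF f] in \<open>auto simp: h_def\<close>)
  also note L2_nn_integral_finite[OF f]
  finally have "g \<in> L2"
    by (auto simp: L2_def integrable_iff_bounded)
  moreover have "((\<lambda>R. \<integral>\<^sup>+ \<xi>. ennreal ((norm (trunc_fourier R f \<xi> - g \<xi>))\<^sup>2) \<partial>lborel) \<longlongrightarrow> 0) at_top"
  proof (rule tendsto_sandwich[OF _ _ tendsto_const L2_tail_tendsto[OF f]])
    show "\<forall>\<^sub>F R in at_top. (\<integral>\<^sup>+ \<xi>. ennreal ((norm (trunc_fourier R f \<xi> - g \<xi>))\<^sup>2) \<partial>lborel) \<le> L2_tail f R"
    proof (rule always_eventually, rule allI)
      fix R
      show "(\<integral>\<^sup>+ \<xi>. ennreal ((norm (trunc_fourier R f \<xi> - g \<xi>))\<^sup>2) \<partial>lborel) \<le> L2_tail f R"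
      proof (rule fatou)
        \<comment> \<open>For fixed \<open>R\<close>, all \<open>h k\<close> with
          \<open>k > R\<close> are truncations at radii above \<open>R\<close>, hence within the
          tail at \<open>R\<close>.\<close>
        have "\<forall>\<^sub>F k in sequentially. R < real k"
          using filterlim_real_sequentially by (simp add: filterlim_at_top_dense)
        then show "\<forall>\<^sub>F k in sequentially. (\<integral>\<^sup>+x. ennreal ((norm (trunc_fourier R f x - h k x))\<^sup>2) \<partial>lborel) \<le> L2_tail f R"
        proof eventually_elim
          fix k assume "R < real k"
          with r_ge[of k] show "(\<integral>\<^sup>+x. ennreal ((norm (trunc_fourier R f x - h k x))\<^sup>2) \<partial>lborel) \<le> L2_tail f R"
            unfolding h_def by (intro trunc_fourier_diff_le[OF f]) simp
        qed
      qed simp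
    qed
  qed simp
  ultimately show ?thesis by blast
qed

lemma
  fixes f :: "'a::euclidean_space \<Rightarrow> complex"
  assumes f: "f \<in> L2"
  shows fourier_L2_in_L2: "fourier_L2 f \<in> L2"
    and fourier_L2_tendsto:
      "((\<lambda>R. \<integral>\<^sup>+ \<xi>. ennreal ((norm (trunc_fourier R f \<xi> - fourier_L2 f \<xi>))\<^sup>2) \<partial>lborel) \<longlongrightarrow> 0) at_top"
  using someI_ex[OF fourier_L2_exists[OF f]] unfolding fourier_L2_def by blast+

text \<open>Compare with the truncated transforms, which satisfy the Plancherel inequality, and let
  \<open>R\<close> tend to infinity. The factor 2 comes from
  \<open>(a + b)^2 \<le> 2 * a^2 + 2 * b^2\<close>.\<close>

lemma fourier_L2_norm_le:
  fixes f :: "'a::euclidean_space \<Rightarrow> complex"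
  assumes f: "f \<in> L2"
  shows "(\<integral>\<^sup>+ \<xi>. ennreal ((norm (fourier_L2 f \<xi>))\<^sup>2) \<partial>lborel) \<le> 2 * (\<integral>\<^sup>+x. ennreal ((norm (f x))\<^sup>2) \<partial>lborel)"
proof -
  let ?g = "fourier_L2 f"
  let ?D = "\<lambda>R. \<integral>\<^sup>+ \<xi>. ennreal ((norm (trunc_fourier R f \<xi> - ?g \<xi>))\<^sup>2) \<partial>lborel"
  let ?N = "\<integral>\<^sup>+x. ennreal ((norm (f x))\<^sup>2) \<partial>lborel"
  have [measurable]: "?g \<in> borel_measurable borel" "trunc_fourier R f \<in> borel_measurable borel" for R
    using fourier_L2_in_L2[OF f] trunc_fourier_measurable[OF f] by (auto simp: L2_def)
  have "(\<integral>\<^sup>+ \<xi>. ennreal ((norm (?g \<xi>))\<^sup>2) \<partial>lborel) \<le> 2 * ?D R + 2 * ?N" for R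
  proof -
    have "(\<integral>\<^sup>+ \<xi>. ennreal ((norm (?g \<xi>))\<^sup>2) \<partial>lborel)
       \<le> (\<integral>\<^sup>+ \<xi>. 2 * ennreal ((norm (trunc_fourier R f \<xi> - ?g \<xi>))\<^sup>2) + 2 * ennreal ((norm (trunc_fourier R f \<xi>))\<^sup>2) \<partial>lborel)"
    proof (rule nn_integral_mono)
      fix \<xi>
      let ?a = "norm (trunc_fourier R f \<xi> - ?g \<xi>)" and ?b = "norm (trunc_fourier R f \<xi>)"
      have "norm (?g \<xi>) \<le> ?a + ?b"
        using norm_triangle_ineq4[of "trunc_fourier R f \<xi>" "trunc_fourier R f \<xi> - ?g \<xi>"] by simp
      then have "(norm (?g \<xi>))\<^sup>2 \<le> (?a + ?b)\<^sup>2" by (intro power_mono) auto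
      also have "\<dots> \<le> 2 * ?a\<^sup>2 + 2 * ?b\<^sup>2"
        using sum_squares_bound[of ?a ?b] by (simp add: power2_sum)
      finally have "ennreal ((norm (?g \<xi>))\<^sup>2) \<le> ennreal (2 * ?a\<^sup>2 + 2 * ?b\<^sup>2)" by (rule ennreal_leI)
      then show "ennreal ((norm (?g \<xi>))\<^sup>2) \<le> 2 * ennreal (?a\<^sup>2) + 2 * ennreal (?b\<^sup>2)"
        by (simp add: ennreal_mult)
    qed
    also have "\<dots> = 2 * ?D R + 2 * (\<integral>\<^sup>+ \<xi>. ennreal ((norm (trunc_fourier R f \<xi>))\<^sup>2) \<partial>lborel)"
      by (simp add: nn_integral_add nn_integral_cmult)
    also have "\<dots> \<le> 2 * ?D R + 2 * ?N"
      by (intro add_left_mono mult_left_mono trunc_fourier_le[OF f]) simp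
    finally show ?thesis .
  qed
  moreover have "((\<lambda>R. 2 * ?D R + 2 * ?N) \<longlongrightarrow> 2 * 0 + 2 * ?N) at_top"
    by (intro tendsto_intros ennreal_tendsto_cmult fourier_L2_tendsto[OF f]) auto
  ultimately show ?thesis
    using tendsto_lowerbound[of "\<lambda>R. 2 * ?D R + 2 * ?N" "2 * ?N" at_top] by simp
qed

section \<open>Radial integrals and the time integral\<close>

text \<open>The set where \<open>norm \<xi> ^ DIM('a) < c\<close> is a ball whose volume is linear
  in \<open>c\<close>, so the image measure has constant density. The minus sign turns these sets
  into preimages of upper rays of finite measure, as \<open>measure_eqI_lessThan\<close>
  requires.\<close>

lemma distr_norm_power_DIM:
  "distr (lborel :: 'a::euclidean_space measure) borel (\<lambda>\<xi>. - (norm \<xi> ^ DIM('a)))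
     = density lborel (\<lambda>s. ennreal (unit_ball_vol DIM('a)) * indicator {..0} s)"
proof -
  let ?V = "unit_ball_vol DIM('a)"
  let ?M = "distr (lborel :: 'a measure) borel (\<lambda>\<xi>. - (norm \<xi> ^ DIM('a)))"
  have M: "emeasure ?M {x<..} = ennreal (?V * max 0 (- x))" for x
  proof -
    have "emeasure ?M {x<..} = emeasure lborel {\<xi>::'a. norm \<xi> ^ DIM('a) < - x}"
      by (subst emeasure_distr) (auto intro!: arg_cong[where f="emeasure lborel"])
    also have "\<dots> = ennreal (?V * max 0 (- x))"
    proof (cases "x < 0")
      case True
      define \<rho> where "\<rho> = root DIM('a) (- x)"
      have \<rho>: "0 \<le> \<rho>" "\<rho> ^ DIM('a) = - x"
        using True by (simp_all add: \<rho>_def)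
      have "norm \<xi> ^ DIM('a) < - x \<longleftrightarrow> norm \<xi> < \<rho>" for \<xi> :: 'a
        using power_mono_iff[of \<rho> "norm \<xi>" "DIM('a)"] \<rho> by (simp add: not_le[symmetric])
      then have "{\<xi>::'a. norm \<xi> ^ DIM('a) < - x} = ball 0 \<rho>"
        by (simp only: ball_def dist_0_norm)
      then show ?thesis
        using True \<rho> by (simp add: emeasure_ball)
    next
      case False
      then have "{\<xi>::'a. norm \<xi> ^ DIM('a) < - x} = {}"
        by (auto simp: not_less intro: order_trans[OF _ zero_le_power])
      then show ?thesis using False by simp
    qed
    finally show ?thesis .
  qed
  have N: "emeasure (density lborel (\<lambda>s. ennreal ?V * indicator {..0} s)) {x<..} = ennreal (?V * max 0 (- x))" for x
  proof -
    have "emeasure (density lborel (\<lambda>s. ennreal ?V * indicator {..0} s)) {x<..}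
        = (\<integral>\<^sup>+s. ennreal ?V * indicator {x<..0} s \<partial>lborel)"
      by (subst emeasure_density) (auto intro!: nn_integral_cong simp: indicator_def)
    also have "\<dots> = ennreal ?V * emeasure lborel {x<..0}"
      by (subst nn_integral_cmult_indicator) auto
    also have "\<dots> = ennreal (?V * max 0 (- x))"
      by (cases "x \<le> 0") (auto simp: max_def simp flip: ennreal_mult)
    finally show ?thesis .
  qed
  show ?thesis
    by (rule measure_eqI_lessThan) (simp_all only: M N, simp_all)
qed

text \<open>This replaces polar coordinates: with \<open>s = norm \<xi> ^ DIM('a)\<close> no power
  of the radius is left over. The reflection \<open>s \<mapsto> - s\<close> undoes the sign
  above.\<close>

lemma nn_integral_norm_power_DIM:
  fixes \<phi> :: "real \<Rightarrow> ennreal"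
  assumes [measurable]: "\<phi> \<in> borel_measurable borel"
  shows "(\<integral>\<^sup>+\<xi>. \<phi> (norm (\<xi>::'a::euclidean_space) ^ DIM('a)) \<partial>lborel)
      = ennreal (unit_ball_vol DIM('a)) * (\<integral>\<^sup>+s. \<phi> s * indicator {0..} s \<partial>lborel)"
proof -
  let ?V = "unit_ball_vol DIM('a)"
  have "(\<integral>\<^sup>+\<xi>. \<phi> (norm (\<xi>::'a) ^ DIM('a)) \<partial>lborel)
      = (\<integral>\<^sup>+s. \<phi> (- s) \<partial>distr (lborel :: 'a measure) borel (\<lambda>\<xi>. - (norm \<xi> ^ DIM('a))))"
    by (subst nn_integral_distr) auto
  also have "\<dots> = (\<integral>\<^sup>+s. ennreal ?V * (\<phi> (- s) * indicator {..0} s) \<partial>lborel)"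
    unfolding distr_norm_power_DIM by (subst nn_integral_density) (auto simp: mult_ac)
  also have "\<dots> = ennreal ?V * (\<integral>\<^sup>+s. \<phi> (- s) * indicator {..0} s \<partial>lborel)"
    by (rule nn_integral_cmult) measurable
  also have "(\<integral>\<^sup>+s. \<phi> (- s) * indicator {..0} s \<partial>lborel) = (\<integral>\<^sup>+s. \<phi> s * indicator {0..} s \<partial>lborel)"
    by (subst nn_integral_real_affine[where c="-1" and t=0])
       (auto intro!: nn_integral_cong simp: indicator_def)
  finally show ?thesis .
qed

text \<open>Euler's integral for \<open>Gamma (1/2)\<close> after scaling by \<open>t\<close>. It
  serves both the frequency and the time integral.\<close>

lemma nn_integral_exp_inv_sqrt:
  fixes t :: real
  assumes t: "t > 0"
  shows "(\<integral>\<^sup>+s. ennreal (exp (- t * s) * s powr (- (1/2))) * indicator {0..} s \<partial>lborel)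
      = ennreal (Gamma (1/2) * t powr (- (1/2)))"
proof -
  let ?J = "\<integral>\<^sup>+s. ennreal (exp (- t * s) * (t * s) powr (- (1/2))) * indicator {0..} s \<partial>lborel"
  have "ennreal (Gamma (1/2)) = (\<integral>\<^sup>+s. ennreal (indicator {0..} s * s powr (1/2 - 1) / exp s) \<partial>lborel)"
    by (rule Gamma_conv_nn_integral_real) simp
  also have "\<dots> = ennreal \<bar>t\<bar> * (\<integral>\<^sup>+s. ennreal (indicator {0..} (0 + t * s) * (0 + t * s) powr (1/2 - 1) / exp (0 + t * s)) \<partial>lborel)"
    using t by (intro nn_integral_real_affine) auto
  also have "(\<integral>\<^sup>+s. ennreal (indicator {0..} (0 + t * s) * (0 + t * s) powr (1/2 - 1) / exp (0 + t * s)) \<partial>lborel) = ?J"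
    using t by (intro nn_integral_cong) (auto simp: indicator_def exp_minus field_simps zero_le_mult_iff)
  finally have G: "ennreal (Gamma (1/2)) = ennreal t * ?J" using t by simp
  have "(\<integral>\<^sup>+s. ennreal (exp (- t * s) * s powr (- (1/2))) * indicator {0..} s \<partial>lborel)
     = (\<integral>\<^sup>+s. ennreal (t powr (1/2)) * (ennreal (exp (- t * s) * (t * s) powr (- (1/2))) * indicator {0..} s) \<partial>lborel)"
  proof (rule nn_integral_cong)
    fix s :: real
    have "exp (- t * s) * s powr (- (1/2)) = t powr (1/2) * (exp (- t * s) * (t * s) powr (- (1/2)))" if "s \<ge> 0"
      using t that by (simp add: powr_mult powr_minus field_simps)
    then show "ennreal (exp (- t * s) * s powr (- (1/2))) * indicator {0..} s
      = ennreal (t powr (1/2)) * (ennreal (exp (- t * s) * (t * s) powr (- (1/2))) * indicator {0..} s)"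
      by (auto simp: indicator_def simp flip: ennreal_mult)
  qed
  also have "\<dots> = ennreal (t powr (1/2)) * ?J"
    by (rule nn_integral_cmult) measurable
  \<comment> \<open>The split-off factor \<open>t\<close> is the Jacobian in
    \<open>G\<close>.\<close>
  also have "t powr (1/2) = t powr (- (1/2)) * t"
    using t powr_add[of t "- (1/2)" 1] by simp
  also have "ennreal (t powr (- (1/2)) * t) * ?J = ennreal (t powr (- (1/2))) * ennreal (Gamma (1/2))"
    using t by (simp add: G ennreal_mult mult.assoc)
  also have "\<dots> = ennreal (Gamma (1/2) * t powr (- (1/2)))"
    by (simp add: mult.commute flip: ennreal_mult)
  finally show ?thesis .
qed

text \<open>The decay \<open>t powr (- (1/2))\<close> of the first factor is placed inside the
  second integral, ready for integration in time.\<close>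

lemma weighted_cauchy_schwarz:
  fixes g :: "'a::euclidean_space \<Rightarrow> complex"
  assumes [measurable]: "g \<in> borel_measurable borel" and t: "t > 0"
  shows "(\<integral>\<^sup>+\<xi>. ennreal (exp (- t * norm \<xi> ^ DIM('a)) * norm (g \<xi>)) \<partial>lborel)\<^sup>2
     \<le> ennreal (unit_ball_vol DIM('a) * Gamma (1/2)) *
       (\<integral>\<^sup>+\<xi>. ennreal (t powr (- (1/2)) * exp (- t * norm \<xi> ^ DIM('a)) * (norm \<xi> ^ DIM('a)) powr (1/2) * (norm (g \<xi>))\<^sup>2) \<partial>lborel)"
proof -
  let ?V = "unit_ball_vol DIM('a)"
  define s where "s \<xi> = norm \<xi> ^ DIM('a)" for \<xi> :: 'a
  have [measurable]: "s \<in> borel_measurable borel" unfolding s_def by measurable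
  \<comment> \<open>In the variable \<open>s\<close> the exponents are a quarter, so that squaring
    \<open>p\<close> gives exactly the integrand of \<open>nn_integral_exp_inv_sqrt\<close>.\<close>
  define p where "p \<xi> = ennreal (exp (- t * s \<xi> / 2) * s \<xi> powr (- (1/4)))" for \<xi>
  define q where "q \<xi> = ennreal (exp (- t * s \<xi> / 2) * s \<xi> powr (1/4) * norm (g \<xi>))" for \<xi>
  have ex: "exp (- t * s \<xi> / 2) * exp (- t * s \<xi> / 2) = exp (- t * s \<xi>)" for \<xi>
    by (simp flip: exp_add)
  have pq: "(\<integral>\<^sup>+\<xi>. ennreal (exp (- t * s \<xi>) * norm (g \<xi>)) \<partial>lborel) = (\<integral>\<^sup>+\<xi>. p \<xi> * q \<xi> \<partial>lborel)"
  \<comment> \<open>The origin is excluded because \<open>0 powr (- (1/4)) = 0\<close>, which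
    destroys the cancellation there.\<close>
  proof (rule nn_integral_cong_AE, use AE_lborel_singleton[of "0::'a"] in eventually_elim)
    fix \<xi> :: 'a assume "\<xi> \<noteq> 0"
    then have "s \<xi> > 0" by (simp add: s_def)
    then have "s \<xi> powr (- (1/4)) * s \<xi> powr (1/4) = 1" by (simp flip: powr_add)
    then have "exp (- t * s \<xi>) * norm (g \<xi>)
      = exp (- t * s \<xi> / 2) * s \<xi> powr (- (1/4)) * (exp (- t * s \<xi> / 2) * s \<xi> powr (1/4) * norm (g \<xi>))"
      unfolding ex[symmetric] by (simp add: algebra_simps)
    then show "ennreal (exp (- t * s \<xi>) * norm (g \<xi>)) = p \<xi> * q \<xi>"
      by (simp add: p_def q_def flip: ennreal_mult)
  qed
  have p2: "(p \<xi>)\<^sup>2 = ennreal (exp (- t * s \<xi>) * s \<xi> powr (- (1/2)))" for \<xi>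
  proof -
    have pw: "s \<xi> powr (- (1/4)) * s \<xi> powr (- (1/4)) = s \<xi> powr (- (1/2))" by (simp flip: powr_add)
    have "(exp (- t * s \<xi> / 2) * s \<xi> powr (- (1/4)))\<^sup>2
        = (exp (- t * s \<xi> / 2) * exp (- t * s \<xi> / 2)) * (s \<xi> powr (- (1/4)) * s \<xi> powr (- (1/4)))"
      by (simp only: power2_eq_square mult_ac)
    then have "(exp (- t * s \<xi> / 2) * s \<xi> powr (- (1/4)))\<^sup>2 = exp (- t * s \<xi>) * s \<xi> powr (- (1/2))"
      by (simp only: ex pw)
    then show ?thesis
      unfolding p_def by (simp only: ennreal_power mult_nonneg_nonneg exp_ge_zero powr_ge_zero)
  qed
  have q2: "(q \<xi>)\<^sup>2 = ennreal (exp (- t * s \<xi>) * s \<xi> powr (1/2) * (norm (g \<xi>))\<^sup>2)" for \<xi>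
  proof -
    have pw: "s \<xi> powr (1/4) * s \<xi> powr (1/4) = s \<xi> powr (1/2)" by (simp flip: powr_add)
    have "(exp (- t * s \<xi> / 2) * s \<xi> powr (1/4) * norm (g \<xi>))\<^sup>2
        = (exp (- t * s \<xi> / 2) * exp (- t * s \<xi> / 2)) * (s \<xi> powr (1/4) * s \<xi> powr (1/4)) * (norm (g \<xi>))\<^sup>2"
      by (simp only: power2_eq_square mult_ac)
    then have "(exp (- t * s \<xi> / 2) * s \<xi> powr (1/4) * norm (g \<xi>))\<^sup>2 = exp (- t * s \<xi>) * s \<xi> powr (1/2) * (norm (g \<xi>))\<^sup>2"
      by (simp only: ex pw)
    then show ?thesis
      unfolding q_def by (simp only: ennreal_power mult_nonneg_nonneg exp_ge_zero powr_ge_zero norm_ge_zero)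
  qed
  have "(\<integral>\<^sup>+\<xi>. p \<xi> * q \<xi> \<partial>lborel)\<^sup>2 \<le> (\<integral>\<^sup>+\<xi>. (p \<xi>)\<^sup>2 \<partial>lborel) * (\<integral>\<^sup>+\<xi>. (q \<xi>)\<^sup>2 \<partial>lborel)"
    unfolding p_def q_def by (rule Cauchy_Schwarz_nn_integral) measurable
  also have "(\<integral>\<^sup>+\<xi>. (p \<xi>)\<^sup>2 \<partial>lborel) = ennreal (?V * Gamma (1/2)) * ennreal (t powr (- (1/2)))"
    unfolding p2 s_def
    by (subst nn_integral_norm_power_DIM[where \<phi> = "\<lambda>s. ennreal (exp (- t * s) * s powr (- (1/2)))"])
       (simp_all only: nn_integral_exp_inv_sqrt[OF t], simp_all add: mult.assoc flip: ennreal_mult)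
  also have "ennreal (?V * Gamma (1/2)) * ennreal (t powr (- (1/2))) * (\<integral>\<^sup>+\<xi>. (q \<xi>)\<^sup>2 \<partial>lborel)
     = ennreal (?V * Gamma (1/2)) * (\<integral>\<^sup>+\<xi>. ennreal (t powr (- (1/2))) * (q \<xi>)\<^sup>2 \<partial>lborel)"
    unfolding q2 by (subst nn_integral_cmult) (simp_all add: mult.assoc)
  also have "(\<integral>\<^sup>+\<xi>. ennreal (t powr (- (1/2))) * (q \<xi>)\<^sup>2 \<partial>lborel)
     = (\<integral>\<^sup>+\<xi>. ennreal (t powr (- (1/2)) * exp (- t * s \<xi>) * s \<xi> powr (1/2) * (norm (g \<xi>))\<^sup>2) \<partial>lborel)"
    unfolding q2 by (simp add: mult.assoc flip: ennreal_mult)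
  finally show ?thesis
    unfolding pq[symmetric] unfolding s_def .
qed

text \<open>Tonelli puts the time integral inside, where it equals
  \<open>Gamma (1/2) * s powr (- (1/2))\<close> for \<open>s > 0\<close> and cancels the weight. The
  second power of \<open>Gamma (1/2)\<close> comes from using the same integral in frequency and in
  time.\<close>

lemma laplace_L2_bound:
  fixes g :: "'a::euclidean_space \<Rightarrow> complex"
  assumes [measurable]: "g \<in> borel_measurable borel"
  shows "(\<integral>\<^sup>+t\<in>{0<..}. (\<integral>\<^sup>+\<xi>. ennreal (exp (- t * norm \<xi> ^ DIM('a)) * norm (g \<xi>)) \<partial>lborel)\<^sup>2 \<partial>lborel)
     \<le> ennreal (unit_ball_vol DIM('a) * (Gamma (1/2))\<^sup>2) * (\<integral>\<^sup>+\<xi>. ennreal ((norm (g \<xi>))\<^sup>2) \<partial>lborel)"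
proof -
  let ?V = "unit_ball_vol DIM('a)"
  define s where "s \<xi> = norm \<xi> ^ DIM('a)" for \<xi> :: 'a
  have [measurable]: "s \<in> borel_measurable borel" unfolding s_def by measurable
  have s0: "0 \<le> s \<xi>" for \<xi> by (simp add: s_def)
  define F where "F t \<xi> = ennreal (t powr (- (1/2)) * exp (- t * s \<xi>) * s \<xi> powr (1/2) * (norm (g \<xi>))\<^sup>2) * indicator {0<..} t" for t \<xi>
  have F[measurable]: "case_prod F \<in> borel_measurable (lborel \<Otimes>\<^sub>M lborel)"
    unfolding F_def by measurable
  have "(\<integral>\<^sup>+\<xi>. (\<integral>\<^sup>+t. F t \<xi> \<partial>lborel) \<partial>lborel) \<le> (\<integral>\<^sup>+\<xi>. ennreal (Gamma (1/2)) * ennreal ((norm (g \<xi>))\<^sup>2) \<partial>lborel)"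
  proof (rule nn_integral_mono)
    fix \<xi> :: 'a
    show "(\<integral>\<^sup>+t. F t \<xi> \<partial>lborel) \<le> ennreal (Gamma (1/2)) * ennreal ((norm (g \<xi>))\<^sup>2)"
    proof (cases "s \<xi> = 0")
      \<comment> \<open>Here \<open>0 powr (1/2) = 0\<close> makes \<open>F\<close> vanish.\<close>
      case True
      then show ?thesis by (simp add: F_def)
    next
      case False
      then have pos: "s \<xi> > 0" using s0[of \<xi>] by simp
      have "(\<integral>\<^sup>+t. F t \<xi> \<partial>lborel)
         \<le> (\<integral>\<^sup>+t. ennreal (s \<xi> powr (1/2) * (norm (g \<xi>))\<^sup>2) * (ennreal (exp (- s \<xi> * t) * t powr (- (1/2))) * indicator {0..} t) \<partial>lborel)"
        by (intro nn_integral_mono)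
           (auto simp: F_def indicator_def mult_ac simp flip: ennreal_mult)
      also have "\<dots> = ennreal (s \<xi> powr (1/2) * (norm (g \<xi>))\<^sup>2) * ennreal (Gamma (1/2) * s \<xi> powr (- (1/2)))"
        by (subst nn_integral_cmult) (simp_all only: nn_integral_exp_inv_sqrt[OF pos], measurable)
      also have "\<dots> = ennreal ((s \<xi> powr (1/2) * s \<xi> powr (- (1/2))) * (Gamma (1/2) * (norm (g \<xi>))\<^sup>2))"
        by (simp add: mult_ac flip: ennreal_mult)
      also have "s \<xi> powr (1/2) * s \<xi> powr (- (1/2)) = 1"
        using pos by (simp flip: powr_add)
      finally show ?thesis by (simp add: ennreal_mult)
    qed
  qed
  also have "\<dots> = ennreal (Gamma (1/2)) * (\<integral>\<^sup>+\<xi>. ennreal ((norm (g \<xi>))\<^sup>2) \<partial>lborel)"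
    by (rule nn_integral_cmult) measurable
  finally have time: "(\<integral>\<^sup>+\<xi>. (\<integral>\<^sup>+t. F t \<xi> \<partial>lborel) \<partial>lborel)
     \<le> ennreal (Gamma (1/2)) * (\<integral>\<^sup>+\<xi>. ennreal ((norm (g \<xi>))\<^sup>2) \<partial>lborel)" .
  have "(\<integral>\<^sup>+t\<in>{0<..}. (\<integral>\<^sup>+\<xi>. ennreal (exp (- t * norm \<xi> ^ DIM('a)) * norm (g \<xi>)) \<partial>lborel)\<^sup>2 \<partial>lborel)
     \<le> (\<integral>\<^sup>+t. ennreal (?V * Gamma (1/2)) * (\<integral>\<^sup>+\<xi>. F t \<xi> \<partial>lborel) \<partial>lborel)"
  proof (rule nn_integral_mono)
    fix t :: real
    show "(\<integral>\<^sup>+\<xi>. ennreal (exp (- t * norm \<xi> ^ DIM('a)) * norm (g \<xi>)) \<partial>lborel)\<^sup>2 * indicator {0<..} t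
       \<le> ennreal (?V * Gamma (1/2)) * (\<integral>\<^sup>+\<xi>. F t \<xi> \<partial>lborel)"
      using weighted_cauchy_schwarz[of g t] by (cases "t > 0") (simp_all add: F_def s_def)
  qed
  also have "\<dots> = ennreal (?V * Gamma (1/2)) * (\<integral>\<^sup>+t. (\<integral>\<^sup>+\<xi>. F t \<xi> \<partial>lborel) \<partial>lborel)"
    by (rule nn_integral_cmult) measurable
  also have "(\<integral>\<^sup>+t. (\<integral>\<^sup>+\<xi>. F t \<xi> \<partial>lborel) \<partial>lborel) = (\<integral>\<^sup>+\<xi>. (\<integral>\<^sup>+t. F t \<xi> \<partial>lborel) \<partial>lborel)"
    by (rule lborel_pair.Fubini'[symmetric]) fact
  also have "ennreal (?V * Gamma (1/2)) * (\<integral>\<^sup>+\<xi>. (\<integral>\<^sup>+t. F t \<xi> \<partial>lborel) \<partial>lborel)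
     \<le> ennreal (?V * Gamma (1/2)) * (ennreal (Gamma (1/2)) * (\<integral>\<^sup>+\<xi>. ennreal ((norm (g \<xi>))\<^sup>2) \<partial>lborel))"
    by (rule mult_left_mono[OF time]) simp
  also have "\<dots> = ennreal (?V * (Gamma (1/2))\<^sup>2) * (\<integral>\<^sup>+\<xi>. ennreal ((norm (g \<xi>))\<^sup>2) \<partial>lborel)"
  proof -
    have "ennreal (?V * (Gamma (1/2))\<^sup>2) = ennreal (?V * Gamma (1/2)) * ennreal (Gamma (1/2))"
      by (simp add: power2_eq_square mult.assoc flip: ennreal_mult)
    then show ?thesis by (simp only: mult.assoc)
  qed
  finally show ?thesis .
qed

section \<open>Mean oscillation\<close>

lemma emeasure_cube:
  fixes a :: "'a::euclidean_space"
  assumes "l > 0"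
  shows "emeasure lborel (cube a l) = ennreal (l ^ DIM('a))"
proof -
  have "emeasure lborel (cube a l) = ennreal (\<Prod>b\<in>(Basis::'a set). l)"
    unfolding cube_def using assms
    by (subst emeasure_lborel_cbox) (auto simp: inner_add_left)
  then show ?thesis by simp
qed

text \<open>A cube average is bounded by the supremum, so the oscillation is at most
  \<open>2 * m\<close> pointwise. For finite \<open>m\<close> boundedness also gives the
  integrability on cubes that selects the supremum branch of \<open>bmo_sq\<close>; for infinite
  \<open>m\<close> the bound is trivial.\<close>

lemma bmo_sq_le_sup_norm:
  fixes u :: "'a::euclidean_space \<Rightarrow> complex"
  assumes [measurable]: "u \<in> borel_measurable borel"
    and bnd: "\<And>x. ennreal (norm (u x)) \<le> m"
  shows "bmo_sq u \<le> 4 * m\<^sup>2"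
proof (cases m)
  case (real r)
  then have r: "norm (u x) \<le> r" for x using bnd[of x] by simp
  have r0: "r \<ge> 0" using real by simp
  have [measurable]: "cube a l \<in> sets borel" for a :: 'a and l by (simp add: cube_def)
  have int: "set_integrable lborel (cube a l) u" if "l > 0" for a l
    unfolding set_integrable_def
  proof (rule Bochner_Integration.integrable_bound)
    show "integrable lborel (\<lambda>x. r * indicat_real (cube a l) x)"
      using emeasure_cube[OF that, of a] by (intro integrable_mult_right) auto
  qed (use r r0 in \<open>auto simp: indicator_def\<close>)
  have "ennreal (1 / l ^ DIM('a)) *
       (\<integral>\<^sup>+ x \<in> cube a l. ennreal ((norm (u x - cube_avg u (cube a l)))\<^sup>2) \<partial>lborel) \<le> 4 * m\<^sup>2"
    if l: "l > 0" for a l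
  proof -
    have meas: "measure lborel (cube a l) = l ^ DIM('a)"
      using emeasure_cube[OF l, of a] l by (simp add: measure_def)
    have "norm (LINT x : cube a l | lborel. u x) \<le> (LINT x : cube a l | lborel. r)"
      unfolding set_lebesgue_integral_def
    proof (rule Bochner_Integration.integral_norm_bound_integral)
      show "integrable lborel (\<lambda>x. indicat_real (cube a l) x *\<^sub>R u x)"
        using int[OF l, of a] by (simp add: set_integrable_def)
      show "integrable lborel (\<lambda>x. indicat_real (cube a l) x *\<^sub>R r)"
        using emeasure_cube[OF l, of a] by (intro integrable_scaleR_left) auto
    qed (use r in \<open>auto simp: indicator_def\<close>)
    also have "\<dots> = r * l ^ DIM('a)"
      using emeasure_cube[OF l, of a] by (simp add: set_lebesgue_integral_def meas)
    finally have avg: "norm (cube_avg u (cube a l)) \<le> r"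
      using l by (simp add: cube_avg_def meas norm_divide norm_power field_simps)
    have "norm (u x - cube_avg u (cube a l)) \<le> 2 * r" for x
      using norm_triangle_ineq4[of "u x" "cube_avg u (cube a l)"] r[of x] avg by linarith
    then have sq: "(norm (u x - cube_avg u (cube a l)))\<^sup>2 \<le> 4 * r\<^sup>2" for x
      using power_mono[of "norm (u x - cube_avg u (cube a l))" "2 * r" 2] by (simp add: power_mult_distrib)
    have "(\<integral>\<^sup>+ x \<in> cube a l. ennreal ((norm (u x - cube_avg u (cube a l)))\<^sup>2) \<partial>lborel)
       \<le> (\<integral>\<^sup>+ x \<in> cube a l. ennreal (4 * r\<^sup>2) \<partial>lborel)"
      by (intro nn_integral_mono mult_right_mono ennreal_leI sq) auto
    also have "\<dots> = ennreal (4 * r\<^sup>2) * ennreal (l ^ DIM('a))"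
      by (simp add: nn_integral_cmult_indicator emeasure_cube[OF l])
    finally have "ennreal (1 / l ^ DIM('a)) *
       (\<integral>\<^sup>+ x \<in> cube a l. ennreal ((norm (u x - cube_avg u (cube a l)))\<^sup>2) \<partial>lborel)
       \<le> ennreal (1 / l ^ DIM('a)) * (ennreal (4 * r\<^sup>2) * ennreal (l ^ DIM('a)))"
      by (rule mult_left_mono) simp
    also have "\<dots> = ennreal (4 * r\<^sup>2)"
      using l by (simp flip: ennreal_mult)
    also have "\<dots> = 4 * m\<^sup>2"
      using real by (simp add: ennreal_mult ennreal_power)
    finally show ?thesis .
  qed
  then show ?thesis
    using int unfolding bmo_sq_def by (auto intro!: SUP_least)
qed (simp add: ennreal_mult_top power2_eq_square)

lemma frac_heat_bmo_le:
  fixes f :: "'a::euclidean_space \<Rightarrow> complex"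
  assumes f: "f \<in> L2"
  shows "bmo_sq (frac_heat t f)
    \<le> 4 * (\<integral>\<^sup>+\<xi>. ennreal (exp (- t * norm \<xi> ^ DIM('a)) * norm (fourier_L2 f \<xi>)) \<partial>lborel)\<^sup>2"
proof (rule bmo_sq_le_sup_norm)
  have [measurable]: "fourier_L2 f \<in> borel_measurable borel"
    using fourier_L2_in_L2[OF f] by (simp add: L2_def)
  let ?h = "\<lambda>x \<xi>. cis (2 * pi * (x \<bullet> \<xi>)) * complex_of_real (exp (- t * norm \<xi> ^ DIM('a))) * fourier_L2 f \<xi>"
  have "(\<lambda>x. \<integral>\<xi>. ?h x \<xi> \<partial>lborel) \<in> borel_measurable borel"
    by (rule lborel.borel_measurable_lebesgue_integral) measurable
  then show "frac_heat t f \<in> borel_measurable borel"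
    by (simp add: frac_heat_def[abs_def])
  fix x
  show "ennreal (norm (frac_heat t f x)) \<le> (\<integral>\<^sup>+\<xi>. ennreal (exp (- t * norm \<xi> ^ DIM('a)) * norm (fourier_L2 f \<xi>)) \<partial>lborel)"
  proof (cases "integrable lborel (?h x)")
    case True
    from integral_norm_bound_ennreal[OF this] show ?thesis
      by (simp add: frac_heat_def norm_mult)
  next
    \<comment> \<open>The Bochner integral then has its default value 0.\<close>
    case False
    then show ?thesis by (simp add: frac_heat_def not_integrable_integral_eq)
  qed
qed

section \<open>Combining the oscillation, time and Plancherel bounds\<close>

theorem theorem1p6:
  "\<exists>C>0. \<forall>f :: 'a::euclidean_space \<Rightarrow> complex. f \<in> L2 \<longrightarrow>
     (\<integral>\<^sup>+ t \<in> {0<..}. bmo_sq (frac_heat t f) \<partial>lborel)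
       \<le> ennreal C * (\<integral>\<^sup>+ x. ennreal ((norm (f x))\<^sup>2) \<partial>lborel)"
proof (intro exI conjI allI impI)
  define K :: real where "K = unit_ball_vol DIM('a) * (Gamma (1/2))\<^sup>2"
  have K: "K > 0"
    unfolding K_def by (intro mult_pos_pos zero_less_power Gamma_real_pos) auto
  \<comment> \<open>The 4 comes from the oscillation bound, \<open>K\<close> from
    \<open>laplace_L2_bound\<close>, and the 2 from \<open>fourier_L2_norm_le\<close>.\<close>
  then show "4 * (K * 2) > 0" by simp
  fix f :: "'a \<Rightarrow> complex" assume f: "f \<in> L2"
  let ?g = "fourier_L2 f"
  let ?M = "\<lambda>t. \<integral>\<^sup>+\<xi>. ennreal (exp (- t * norm \<xi> ^ DIM('a)) * norm (?g \<xi>)) \<partial>lborel"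
  have [measurable]: "?g \<in> borel_measurable borel"
    using fourier_L2_in_L2[OF f] by (simp add: L2_def)
  have "(\<integral>\<^sup>+ t \<in> {0<..}. bmo_sq (frac_heat t f) \<partial>lborel) \<le> (\<integral>\<^sup>+ t. 4 * ((?M t)\<^sup>2 * indicator {0<..} t) \<partial>lborel)"
    unfolding mult.assoc[symmetric]
    by (intro nn_integral_mono mult_right_mono frac_heat_bmo_le[OF f]) auto
  also have "\<dots> = 4 * (\<integral>\<^sup>+ t\<in>{0<..}. (?M t)\<^sup>2 \<partial>lborel)"
    by (rule nn_integral_cmult) measurable
  also have "\<dots> \<le> 4 * (ennreal K * (\<integral>\<^sup>+ \<xi>. ennreal ((norm (?g \<xi>))\<^sup>2) \<partial>lborel))"
    by (intro mult_left_mono laplace_L2_bound[of ?g, folded K_def]) auto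
  also have "\<dots> \<le> 4 * (ennreal K * (2 * (\<integral>\<^sup>+ x. ennreal ((norm (f x))\<^sup>2) \<partial>lborel)))"
    by (intro mult_left_mono fourier_L2_norm_le[OF f]) auto
  also have "\<dots> = ennreal (4 * (K * 2)) * (\<integral>\<^sup>+ x. ennreal ((norm (f x))\<^sup>2) \<partial>lborel)"
  proof -
    have "4 * (ennreal K * (2 * I)) = (4 * 2) * (ennreal K * I)" for I
      by (simp only: mult_ac)
    then show ?thesis using K by (simp add: ennreal_mult mult.assoc)
  qed
  finally show "(\<integral>\<^sup>+ t \<in> {0<..}. bmo_sq (frac_heat t f) \<partial>lborel)
       \<le> ennreal (4 * (K * 2)) * (\<integral>\<^sup>+ x. ennreal ((norm (f x))\<^sup>2) \<partial>lborel)" .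
qed

end
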